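(* Let $F$ be a distribution function on $\mathbb{R}$, let $0\le\alpha<\gamma\le 1/2$, and let the weight function for the smoothly trimmed mean be $$J(u)=\begin{cases}\frac{u-\alpha}{\gamma-\alpha}, & \alpha\le u<\gamma,\\ 1, & \gamma\le u\le 1-\gamma,\\ \frac{1-u-\alpha}{\gamma-\alpha}, & 1-\gamma<u\le 1-\alpha,\\ 0,&\text{otherwise.}\end{cases}$$ Define $$E_1=E_1(x)=\frac{1}{\gamma-\alpha}\Big(F(x)x-\int_\alpha^{F(x)}F^{-1}(u)\,du-\alpha x\Big),$$ $$E_2=E_2(x)=\frac{1}{\gamma-\alpha}\Big((\gamma-\alpha)F^{-1}(\gamma)-\int_\alpha^\gamma F^{-1}(u)\,du\Big)+x-F^{-1}(\gamma),$$ $$\begin{aligned}E_3=E_3(x)={}&\frac{1}{\gamma-\alpha}\Big((\gamma-\alpha)F^{-1}(\gamma)-\int_\alpha^\gamma F^{-1}(u)\,du\Big)+F^{-1}(1-\gamma)-F^{-1}(\gamma)\\&+\frac{1}{\gamma-\alpha}\Big((1-\alpha)x+(\alpha-\gamma)F^{-1}(1-\gamma)-F(x)x+\int_{1-\gamma}^{F(x)}F^{-1}(u)\,du\Big),\end{aligned}$$ $$\begin{aligned}E_4={}&\frac{1}{\gamma-\alpha}\Big((\gamma-\alpha)F^{-1}(\gamma)-\int_\alpha^\gamma F^{-1}(u)\,du\Big)+F^{-1}(1-\gamma)-F^{-1}(\gamma)\\&+\frac{1}{\gamma-\alpha}\Big((\alpha-\gamma)F^{-1}(1-\gamma)+\int_{1-\gamma}^{1-\alpha}F^{-1}(u)\,du\Big),\end{aligned}$$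 $$\begin{aligned}I={}&\frac{1}{\gamma-\alpha}\Big((\gamma+\alpha\gamma-\gamma^2-\alpha)F^{-1}(\gamma)-(1+\alpha)\int_\alpha^\gamma F^{-1}(u)\,du+2\int_\alpha^\gamma uF^{-1}(u)\,du\\&\quad+(2-\alpha)\int_{1-\gamma}^{1-\alpha}F^{-1}(u)\,du+(\alpha\gamma-\gamma^2)F^{-1}(1-\gamma)-2\int_{1-\gamma}^{1-\alpha}uF^{-1}(u)\,du\Big)\\&+\int_\gamma^{1-\gamma}F^{-1}(u)\,du+F^{-1}(1-\gamma)\gamma+F^{-1}(\gamma)\gamma-F^{-1}(\gamma).\end{aligned}$$ Then the influence function of the smoothly trimmed mean is $$IF(x,T,F)=\begin{cases}-I,& x<F^{-1}(\alpha),\\ E_1-I,& F^{-1}(\alpha)\le x<F^{-1}(\gamma),\\ E_2-I,& F^{-1}(\gamma)\le x\le F^{-1}(1-\gamma),\\ E_3-I,& F^{-1}(1-\gamma)<x\le F^{-1}(1-\alpha),\\ E_4-I,& x>F^{-1}(1-\alpha),\end{cases}$$ and the asymptotic variance is $$\begin{aligned}D(\overline{X}_{ST})={}&\alpha I^2+\int_{F^{-1}(\alpha)}^{F^{-1}(\gamma)}(E_1-I)^2\,dF(x)+\int_{F^{-1}(\gamma)}^{F^{-1}(1-\gamma)}(E_2-I)^2\,dF(x)\\&+\int_{F^{-1}(1-\gamma)}^{F^{-1}(1-\alpha)}(E_3-I)^2\,dF(x)+\alpha(E_4-I)^2.\end{aligned}$$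
   Context: $F^{-1}$ denotes the quantile function, $F^{-1}(p)=\inf\{x:F(x)\ge p\}$. For i.i.d. $X_1,\dots,X_n$ with distribution function $F$ and order statistics $X_{(1)}\le\dots\le X_{(n)}$, the smoothly trimmed mean with weight function $J$ is $\overline{X}_{ST}=\frac1n\sum_{i=1}^n J\big(\frac{i}{n+1}\big)X_{(i)}$; the corresponding functional is $T(F)=\int_0^1 J(u)F^{-1}(u)\,du$. Here $\alpha$ is the trimming proportion and $\gamma$ the smoothing proportion. The influence function of such an L-estimator is given by $$IF(x,T,F)=\int_{-\infty}^x J(F(y))\,dy-\int_{-\infty}^\infty(1-F(y))J(F(y))\,dy$$ (the integrals being assumed to converge), and the asymptotic variance is $$D(\overline{X}_{ST})=D(T,F)=\int IF^2(x,T,F)\,dF(x).$$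
   Formalization: With atoms at F^{-1}(α) or F^{-1}(1-α) the variance formula with interval integrals dF can fail; it is proved for every F with end-point atoms split by level, and literally if F is continuous there (α>0). The integrals of F^{-1} in I are assumed to converge. *)

theory Defs
  imports "HOL-Probability.Probability"
begin

(* These are the hypotheses of real_distribution_interval_measure and cdf_interval_measure, so
   interval_measure F is the probability law whose cdf is F, and "dF" is integration against it. *)
definition distribution_function :: "(real \<Rightarrow> real) \<Rightarrow> bool" where
  "distribution_function F \<longleftrightarrow>
     mono F \<and> (\<forall>a. continuous (at_right a) F) \<and> (F \<longlongrightarrow> 0) at_bot \<and> (F \<longlongrightarrow> 1) at_top"

(* Extended-real valued: quantile F 0 is -\<infinity>, and quantile F 1 is \<infinity> when F never reaches 1;
   both levels occur as interval ends when \<alpha> = 0. For 0 < p < 1 the value is finite. *)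
definition quantile :: "(real \<Rightarrow> real) \<Rightarrow> real \<Rightarrow> ereal" where
  "quantile F p = (INF x\<in>{x. p \<le> F x}. ereal x)"

definition Q :: "(real \<Rightarrow> real) \<Rightarrow> real \<Rightarrow> real" where
  "Q F p = real_of_ereal (quantile F p)"

definition ST_weight :: "real \<Rightarrow> real \<Rightarrow> real \<Rightarrow> real" where
  "ST_weight \<alpha> \<gamma> u =
     (if \<alpha> \<le> u \<and> u < \<gamma> then (u - \<alpha>) / (\<gamma> - \<alpha>)
      else if \<gamma> \<le> u \<and> u \<le> 1 - \<gamma> then 1
      else if 1 - \<gamma> < u \<and> u \<le> 1 - \<alpha> then (1 - u - \<alpha>) / (\<gamma> - \<alpha>)
      else 0)"

(* Influence function of the L-functional T(F) = \<integral>\<^sub>0\<^sup>1 J(u) F\<^sup>-\<^sup>1(u) du. *)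
definition L_influence :: "(real \<Rightarrow> real) \<Rightarrow> (real \<Rightarrow> real) \<Rightarrow> real \<Rightarrow> real" where
  "L_influence J F x =
     (LBINT y:{..x}. J (F y)) - (LBINT y. (1 - F y) * J (F y))"

definition L_influence_converges :: "(real \<Rightarrow> real) \<Rightarrow> (real \<Rightarrow> real) \<Rightarrow> bool" where
  "L_influence_converges J F \<longleftrightarrow>
     (\<forall>x. set_integrable lborel {..x} (\<lambda>y. J (F y))) \<and>
     integrable lborel (\<lambda>y. (1 - F y) * J (F y))"

definition L_asymp_variance :: "(real \<Rightarrow> real) \<Rightarrow> (real \<Rightarrow> real) \<Rightarrow> real" where
  "L_asymp_variance J F = (LINT x|interval_measure F. (L_influence J F x)\<^sup>2)"

definition E1 :: "(real \<Rightarrow> real) \<Rightarrow> real \<Rightarrow> real \<Rightarrow> real \<Rightarrow> real" where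
  "E1 F \<alpha> \<gamma> x =
     1 / (\<gamma> - \<alpha>) * (F x * x - (LBINT u=ereal \<alpha>..ereal (F x). Q F u) - \<alpha> * x)"

definition E2 :: "(real \<Rightarrow> real) \<Rightarrow> real \<Rightarrow> real \<Rightarrow> real \<Rightarrow> real" where
  "E2 F \<alpha> \<gamma> x =
     1 / (\<gamma> - \<alpha>) * ((\<gamma> - \<alpha>) * Q F \<gamma> - (LBINT u=ereal \<alpha>..ereal \<gamma>. Q F u)) + x - Q F \<gamma>"

definition E3 :: "(real \<Rightarrow> real) \<Rightarrow> real \<Rightarrow> real \<Rightarrow> real \<Rightarrow> real" where
  "E3 F \<alpha> \<gamma> x =
     1 / (\<gamma> - \<alpha>) * ((\<gamma> - \<alpha>) * Q F \<gamma> - (LBINT u=ereal \<alpha>..ereal \<gamma>. Q F u))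
     + Q F (1 - \<gamma>) - Q F \<gamma>
     + 1 / (\<gamma> - \<alpha>) * ((1 - \<alpha>) * x + (\<alpha> - \<gamma>) * Q F (1 - \<gamma>) - F x * x
         + (LBINT u=ereal (1 - \<gamma>)..ereal (F x). Q F u))"

definition E4 :: "(real \<Rightarrow> real) \<Rightarrow> real \<Rightarrow> real \<Rightarrow> real" where
  "E4 F \<alpha> \<gamma> =
     1 / (\<gamma> - \<alpha>) * ((\<gamma> - \<alpha>) * Q F \<gamma> - (LBINT u=ereal \<alpha>..ereal \<gamma>. Q F u))
     + Q F (1 - \<gamma>) - Q F \<gamma>
     + 1 / (\<gamma> - \<alpha>) * ((\<alpha> - \<gamma>) * Q F (1 - \<gamma>)
         + (LBINT u=ereal (1 - \<gamma>)..ereal (1 - \<alpha>). Q F u))"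

definition I0 :: "(real \<Rightarrow> real) \<Rightarrow> real \<Rightarrow> real \<Rightarrow> real" where
  "I0 F \<alpha> \<gamma> =
     1 / (\<gamma> - \<alpha>) *
       ((\<gamma> + \<alpha> * \<gamma> - \<gamma>\<^sup>2 - \<alpha>) * Q F \<gamma>
        - (1 + \<alpha>) * (LBINT u=ereal \<alpha>..ereal \<gamma>. Q F u)
        + 2 * (LBINT u=ereal \<alpha>..ereal \<gamma>. u * Q F u)
        + (2 - \<alpha>) * (LBINT u=ereal (1 - \<gamma>)..ereal (1 - \<alpha>). Q F u)
        + (\<alpha> * \<gamma> - \<gamma>\<^sup>2) * Q F (1 - \<gamma>)
        - 2 * (LBINT u=ereal (1 - \<gamma>)..ereal (1 - \<alpha>). u * Q F u))
     + (LBINT u=ereal \<gamma>..ereal (1 - \<gamma>). Q F u)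
     + Q F (1 - \<gamma>) * \<gamma> + Q F \<gamma> * \<gamma> - Q F \<gamma>"

(* The integral of g dF from F\<^sup>-\<^sup>1(p) to F\<^sup>-\<^sup>1(q), taken over exactly the F-mass q - p lying between
   the levels p and q: an atom of F at an end point contributes only the part of its mass between
   these levels. If F is continuous at both ends, this is the integral of g against
   interval_measure F over the interval between the two quantiles. *)
definition quantile_range_integral ::
    "(real \<Rightarrow> real) \<Rightarrow> real \<Rightarrow> real \<Rightarrow> (real \<Rightarrow> real) \<Rightarrow> real" where
  "quantile_range_integral F p q g = (LBINT u=ereal p..ereal q. g (Q F u))"

end

theory Submission
  imports Defs
begin

text \<open>
  Every integral over the line in the statement has the form $\int H(F(y))\,dy$, where $H$ is a
  piecewise polynomial with $H(0) = H(1) = 0$. Write $H(t) = \int_0^t w(u)\,du$. Since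
  $u \le F(y)$ holds exactly when $F^{-1}(u) \le y$, the integrand is
  $\int w(u)\,1[F^{-1}(u) \le y]\,du$, and exchanging the integrals gives
  \[ \int H(F(y))\,dy = - \int_0^1 w(u) F^{-1}(u)\,du, \qquad
     \int_{-\infty}^x H(F(y))\,dy = - \int_0^1 w(u) \min(x, F^{-1}(u))\,du . \]
  The exchange is legitimate because $\int w = 0$ lets one subtract $1[0 \le y]$ from the
  indicator, after which the inner integral in $y$ is finite (\<open>layer_cake_signed\<close>,
  \<open>integral_primitive_cdf\<close>).

  For $H = J$ the density $w$ is $\pm 1/(\gamma-\alpha)$ on the two smoothing intervals
  $(\alpha,\gamma)$ and $(1-\gamma,1-\alpha)$, and the second formula expresses
  $\int_{-\infty}^x J(F(y))\,dy$ by the integrals of $\min(x,F^{-1})$ over them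
  (\<open>integral_J_F_atMost\<close>). The minimum is $x$, $F^{-1}$, or changes from one to the other at
  the level $F(x)$, according to the position of $x$ relative to the quantiles at the ends of the
  interval; this produces the five cases. For $H(t) = (1-t)J(t)$ the first formula is the
  constant $I$ (\<open>I0_eq_integral\<close>).

  The five formulas for $\int_{-\infty}^x J(F(y))\,dy$ are valid on closed ranges: neighbouring ones
  agree where their ranges meet, whether or not $F$ jumps there. Hence, after the substitution
  $x = F^{-1}(u)$, which carries Lebesgue measure on $(0,1)$ to the law of $F$, the variance
  splits along the levels $\alpha, \gamma, 1-\gamma, 1-\alpha$ with one formula on each
  piece. All pieces are integrable because $0 \le \int_{-\infty}^x J(F(y))\,dy
  \le \int J(F(y))\,dy < \infty$ bounds the influence function, even when $F$ has infinite variance.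
  For the version over ranges of $x$ it remains to see that each of the two outer ranges has mass
  $\alpha$: for $\alpha > 0$ by continuity at the outer quantiles, for $\alpha = 0$ because
  nothing lies below $F^{-1}(0) = -\infty$ and no mass above $F^{-1}(1)$.
\<close>

section \<open>Integrals of primitives along a threshold\<close>

text \<open>The layer cake formula for a signed weight of total mass zero. The zero mass replaces the two
  bounds at infinity: with \<open>{0..}\<close> subtracted from \<open>{R u..}\<close>, the integral over
  \<open>y\<close> is the signed length from \<open>R u\<close> to \<open>0\<close>, so \<open>R\<close> may be unbounded in both directions.\<close>

lemma layer_cake_signed:
  fixes w R :: "'a \<Rightarrow> real"
  assumes "sigma_finite_measure M" and w: "integrable M w" and R[measurable]: "R \<in> borel_measurable M"
    and wR: "integrable M (\<lambda>u. w u * R u)" and zero: "(LINT u|M. w u) = 0"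
  shows "integrable lborel (\<lambda>y. LINT u|M. w u * indicator {R u..} y)"
    and "(LBINT y. LINT u|M. w u * indicator {R u..} y) = - (LINT u|M. w u * R u)"
proof -
  interpret M: sigma_finite_measure M by fact
  interpret P: pair_sigma_finite M lborel ..
  have [measurable]: "w \<in> borel_measurable M" using w by simp
  \<comment> \<open>The subtracted indicator disappears after integration over \<open>u\<close> and makes \<open>k u\<close> integrable.\<close>
  define k where "k u y = w u * (indicator {R u..} y - indicator {0..} y)" for u and y :: real
  have k_alt: "k u y = w u * (indicator {R u..<0} y - indicator {0..<R u} y)" for u y
    by (auto simp: k_def split: split_indicator)
  have k_abs: "norm (k u y) = \<bar>w u\<bar> * (indicator {R u..<0} y + indicator {0..<R u} y)" for u y
    by (auto simp: k_alt split: split_indicator)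
  have k_meas[measurable]: "case_prod k \<in> borel_measurable (M \<Otimes>\<^sub>M lborel)"
  proof -
    have "case_prod k = (\<lambda>(u, y). w u * ((if R u \<le> y then 1 else 0) - (if 0 \<le> y then 1 else 0)))"
      by (auto simp: k_def fun_eq_iff split: split_indicator)
    then show ?thesis by simp
  qed
  have ind: "has_bochner_integral lborel (indicator {a..<b} :: real \<Rightarrow> real) (max 0 (b - a))" for a b :: real
    by (cases "a \<le> b") (use has_bochner_integral_real_indicator[of "{a..<b}" lborel] in auto)
  have k1: "has_bochner_integral lborel (k u) (- (w u * R u))" for u
  proof -
    have "has_bochner_integral lborel (k u) (w u * (max 0 (0 - R u) - max 0 (R u - 0)))"
      unfolding k_alt[abs_def] by (intro has_bochner_integral_mult_right has_bochner_integral_diff ind)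
    moreover have "max 0 (0 - R u) - max 0 (R u - 0) = - R u" by auto
    ultimately show ?thesis by (simp only:) simp
  qed
  have k2: "has_bochner_integral lborel (\<lambda>y. norm (k u y)) (\<bar>w u * R u\<bar>)" for u
  proof -
    have "has_bochner_integral lborel (\<lambda>y. norm (k u y)) (\<bar>w u\<bar> * (max 0 (0 - R u) + max 0 (R u - 0)))"
      unfolding k_abs by (intro has_bochner_integral_mult_right has_bochner_integral_add ind)
    moreover have "max 0 (0 - R u) + max 0 (R u - 0) = \<bar>R u\<bar>" by auto
    ultimately show ?thesis by (simp only: abs_mult)
  qed
  have k_int: "integrable (M \<Otimes>\<^sub>M lborel) (case_prod k)"
  proof (rule P.Fubini_integrable)
    show "integrable M (\<lambda>u. LBINT y. norm (case (u, y) of (u, y) \<Rightarrow> k u y))"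
      using integrable_abs[OF wR] by (simp add: has_bochner_integral_integral_eq[OF k2] del: real_norm_def)
    show "AE u in M. integrable lborel (\<lambda>y. case (u, y) of (u, y) \<Rightarrow> k u y)"
      using k1 by (auto simp: has_bochner_integral_iff)
  qed simp
  have inner: "(LINT u|M. k u y) = (LINT u|M. w u * indicator {R u..} y)" for y
  proof -
    have "integrable M (\<lambda>u. w u * indicator {R u..} y)"
      by (rule Bochner_Integration.integrable_bound[OF w])
         (auto simp: indicator_def)
    then have "(LINT u|M. w u * indicator {R u..} y - w u * indicator {0..} y)
        = (LINT u|M. w u * indicator {R u..} y) - (LINT u|M. w u) * indicator {0..} y"
      using w by simp
    then show ?thesis by (simp add: k_def right_diff_distrib zero)
  qed
  show "integrable lborel (\<lambda>y. LINT u|M. w u * indicator {R u..} y)"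
    using P.integrable_snd[OF k_int] by (simp add: inner)
  show "(LBINT y. LINT u|M. w u * indicator {R u..} y) = - (LINT u|M. w u * R u)"
    using P.Fubini_integral[OF k_int] by (simp add: inner has_bochner_integral_integral_eq[OF k1])
qed

text \<open>The upper end of integration is \<open>t\<close> clamped to \<open>[p, r]\<close>, so that all positions of \<open>t\<close>
  are covered by one formula.\<close>

lemma integral_affine_below:
  fixes a b p r t :: real
  assumes "p \<le> r"
  defines "c \<equiv> max p (min r t)"
  shows "has_bochner_integral lborel (\<lambda>u. indicator {p<..<r} u * (a + b * u) * indicator {..t} u)
           (a * (c - p) + b * (c\<^sup>2 - p\<^sup>2) / 2)"
proof -
  have c: "p \<le> c" using assms by auto
  have "has_bochner_integral lborel (\<lambda>u. (a + b * u) * indicator {p..c} u)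
          ((a * c + b * c\<^sup>2 / 2) - (a * p + b * p\<^sup>2 / 2))"
    by (rule has_bochner_integral_FTC_Icc_real[OF c])
       (auto intro!: derivative_eq_intros continuous_intros)
  moreover have "(a * c + b * c\<^sup>2 / 2) - (a * p + b * p\<^sup>2 / 2) = a * (c - p) + b * (c\<^sup>2 - p\<^sup>2) / 2"
    by (simp add: field_simps)
  moreover have "AE u in lborel. (a + b * u) * indicator {p..c} u
      = indicator {p<..<r} u * (a + b * u) * indicator {..t} u"
    using AE_lborel_singleton[of p] AE_lborel_singleton[of r] AE_lborel_singleton[of c]
    by eventually_elim (use assms in \<open>auto split: split_indicator\<close>)
  ultimately show ?thesis
    by (subst (asm) has_bochner_integral_cong_AE) auto
qed

lemma integrable_indicator_Ioo: "integrable lborel (indicator {p<..<r::real} :: real \<Rightarrow> real)"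
  by (cases "p \<le> r") (auto intro!: integrable_real_indicator)

section \<open>A distribution function and its quantile function\<close>

locale real_cdf =
  fixes F :: "real \<Rightarrow> real"
  assumes distribution_function: "distribution_function F"
begin

lemma F_mono: "x \<le> y \<Longrightarrow> F x \<le> F y"
  using distribution_function by (auto simp: distribution_function_def mono_def)

lemma F_right_cont: "continuous (at_right a) F"
  using distribution_function by (auto simp: distribution_function_def)

lemma F_at_bot: "(F \<longlongrightarrow> 0) at_bot" and F_at_top: "(F \<longlongrightarrow> 1) at_top"
  using distribution_function by (auto simp: distribution_function_def)

lemma F_bounds: "0 \<le> F x" "F x \<le> 1"
proof -
  show "0 \<le> F x"
    by (rule tendsto_upperbound[OF F_at_bot])
       (auto simp: eventually_at_bot_linorder intro: F_mono)
  show "F x \<le> 1"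
    by (rule tendsto_lowerbound[OF F_at_top])
       (auto simp: eventually_at_top_linorder intro: F_mono)
qed

text \<open>The Galois connection between \<open>F\<close> and its quantile function. It holds at every level,
  including 0 and 1, because the quantile is extended-real valued; right continuity makes the
  infimum attained whenever it is finite.\<close>

lemma quantile_le_iff: "quantile F p \<le> ereal x \<longleftrightarrow> p \<le> F x"
proof
  assume "p \<le> F x"
  then show "quantile F p \<le> ereal x" by (auto simp: quantile_def intro: INF_lower)
next
  assume q: "quantile F p \<le> ereal x"
  have "p \<le> F y" if "x < y" for y
  proof -
    have "quantile F p < ereal y" using q that by (simp add: le_less_trans)
    then obtain z where "p \<le> F z" "z < y" by (auto simp: quantile_def INF_less_iff)
    then show ?thesis using F_mono[of z y] by simp
  qed
  then have "\<forall>\<^sub>F y in at_right x. p \<le> F y" by (auto simp: eventually_at_filter)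
  moreover have "(F \<longlongrightarrow> F x) (at_right x)" using F_right_cont by (simp add: continuous_within)
  ultimately show "p \<le> F x" by (intro tendsto_lowerbound) auto
qed

lemma less_quantile_iff: "ereal x < quantile F p \<longleftrightarrow> F x < p"
  using quantile_le_iff[of p x] by (simp add: not_le[symmetric])

lemma quantile_mono: "p \<le> r \<Longrightarrow> quantile F p \<le> quantile F r"
  unfolding quantile_def by (intro INF_superset_mono) auto

lemma quantile_finite:
  assumes "0 < p" "p < 1"
  shows "quantile F p = ereal (Q F p)"
proof -
  have "\<exists>x. F x < p"
    using order_tendstoD(2)[OF F_at_bot assms(1)] by (auto simp: eventually_at_bot_linorder)
  moreover have "\<exists>x. p < F x"
    using order_tendstoD(1)[OF F_at_top assms(2)] by (auto simp: eventually_at_top_linorder)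
  ultimately obtain a b where "ereal a < quantile F p" "quantile F p \<le> ereal b"
    by (metis less_quantile_iff quantile_le_iff less_imp_le)
  then show ?thesis unfolding Q_def by (cases "quantile F p") auto
qed

lemma Q_le_iff: "0 < p \<Longrightarrow> p < 1 \<Longrightarrow> Q F p \<le> x \<longleftrightarrow> p \<le> F x"
  using quantile_le_iff[of p x] by (simp add: quantile_finite)

lemma le_Q_iff: "0 < p \<Longrightarrow> p < 1 \<Longrightarrow> x \<le> Q F p \<longleftrightarrow> ereal x \<le> quantile F p"
  by (simp add: quantile_finite)

lemma Q_mono: "0 < p \<Longrightarrow> p \<le> r \<Longrightarrow> r < 1 \<Longrightarrow> Q F p \<le> Q F r"
  using quantile_mono[of p r] by (simp add: quantile_finite)

text \<open>Monotonicity gives measurability on the unit interval; elsewhere the quantile is infinite,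
  hence \<open>Q\<close> is 0, except possibly at level 1.\<close>

lemma measurable_Q[measurable]: "Q F \<in> borel_measurable borel"
proof -
  have "(\<lambda>p. Q F p) \<in> borel_measurable (restrict_space borel {0<..<1})"
    by (intro borel_measurable_mono_on_fnc) (auto simp: monotone_on_def intro: Q_mono)
  then have [measurable]: "(\<lambda>p. Q F p * indicator {0<..<1} p) \<in> borel_measurable borel"
    by (subst (asm) borel_measurable_restrict_space_iff) (auto simp: mult.commute)
  have lo: "Q F p = 0" if "p \<le> 0" for p
  proof -
    have "quantile F p = -\<infinity>"
      by (rule ereal_bot) (use that F_bounds in \<open>auto simp: quantile_le_iff intro: order_trans\<close>)
    then show ?thesis by (simp add: Q_def)
  qed
  have hi: "Q F p = 0" if "1 < p" for p
  proof -
    have "{x. p \<le> F x} = {}" using that F_bounds(2) by (auto simp: not_le intro: le_less_trans)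
    then show ?thesis by (simp add: Q_def quantile_def top_ereal_def)
  qed
  have "Q F p = (if p = 1 then Q F 1 else Q F p * indicator {0<..<1} p)" for p
    using lo[of p] hi[of p] by (auto split: split_indicator)
  then have "Q F = (\<lambda>p. if p = 1 then Q F 1 else Q F p * indicator {0<..<1} p)" by blast
  also have "\<dots> \<in> borel_measurable borel" by measurable
  finally show ?thesis .
qed

lemma real_distribution_law: "real_distribution (interval_measure F)"
  by (intro real_distribution_interval_measure F_mono F_right_cont F_at_bot F_at_top)

lemma cdf_law: "cdf (interval_measure F) = F"
  by (intro cdf_interval_measure F_mono F_right_cont F_at_bot)

text \<open>The quantile transform: \<open>Q F\<close> of a uniform variable on the unit interval has distribution
  function \<open>F\<close>.\<close>

lemma integral_interval_measure:
  fixes g :: "real \<Rightarrow> real"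
  assumes g[measurable]: "g \<in> borel_measurable borel"
  shows "(LINT x|interval_measure F. g x) = (LBINT u=0..1. g (Q F u))"
proof -
  interpret cdf_distribution "interval_measure F"
    unfolding cdf_distribution_def by (rule real_distribution_law)
  have C: "C = F" by (rule cdf_law)
  \<comment> \<open>\<open>I\<close> is the real-valued pseudoinverse of \<open>F\<close>, characterised by the same Galois connection.\<close>
  have IQ: "I u = Q F u" if "0 < u" "u < 1" for u
  proof -
    have "I u \<le> x \<longleftrightarrow> Q F u \<le> x" for x
      using that pseudoinverse[of u x] Q_le_iff[of u x] by (simp add: C)
    then show ?thesis by (meson order_antisym order_refl)
  qed
  have "(LINT x|interval_measure F. g x)
      = (LINT x|distr (restrict_space lborel {0<..<1::real}) borel I. g x)"
    by (simp only: distr_I_eq_M)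
  also have "\<dots> = (LINT u|restrict_space lborel {0<..<1}. g (I u))"
    by (rule integral_distr) (simp_all add: measurable_CI[unfolded C])
  also have "\<dots> = (LBINT u:{0<..<1}. g (I u))"
    by (subst integral_restrict_space) (auto simp: set_lebesgue_integral_def)
  also have "\<dots> = (LBINT u:{0<..<1}. g (Q F u))"
    by (rule set_lebesgue_integral_cong) (auto simp: IQ)
  also have "\<dots> = (LBINT u=0..1. g (Q F u))"
    by (simp add: interval_lebesgue_integral_le_eq zero_ereal_def one_ereal_def)
  finally show ?thesis .
qed

lemma F_Q_eq:
  assumes "0 < p" "p < 1" "isCont F (Q F p)"
  shows "F (Q F p) = p"
proof (rule antisym)
  show "p \<le> F (Q F p)" using Q_le_iff[of p "Q F p"] assms by simp
  have "(F \<longlongrightarrow> F (Q F p)) (at_left (Q F p))"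
    using assms(3) by (simp add: isCont_def filterlim_at_split)
  moreover have "F y \<le> p" if "y < Q F p" for y
    using Q_le_iff[of p y] assms that by simp
  then have "\<forall>\<^sub>F y in at_left (Q F p). F y \<le> p" by (auto simp: eventually_at_filter)
  ultimately show "F (Q F p) \<le> p" by (rule tendsto_upperbound) simp
qed

lemma measure_below_quantile:
  assumes "0 \<le> p" "p < 1" "p > 0 \<Longrightarrow> isCont F (Q F p)"
  shows "measure (interval_measure F) {x. ereal x < quantile F p} = p"
proof (cases "p = 0")
  case True
  then have "{x. ereal x < quantile F p} = {}"
    using F_bounds(1) by (auto simp: less_quantile_iff not_less)
  with True show ?thesis by simp
next
  case False
  with assms have p: "0 < p" "p < 1" "isCont F (Q F p)" by auto
  interpret real_distribution "interval_measure F" by (rule real_distribution_law)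
  have "measure (interval_measure F) {..Q F p}
      = measure (interval_measure F) {..<Q F p} + measure (interval_measure F) {Q F p}"
    by (subst finite_measure_Union[symmetric]) (auto intro!: arg_cong[where f = "measure _"])
  moreover have "measure (interval_measure F) {Q F p} = 0"
    using p(3) isCont_cdf[of "Q F p"] by (simp add: cdf_law)
  moreover have "measure (interval_measure F) {..Q F p} = p"
    using F_Q_eq[OF p] fun_cong[OF cdf_law, of "Q F p"] by (simp add: cdf_def)
  moreover have "{x. ereal x < quantile F p} = {..<Q F p}"
    using p by (auto simp: quantile_finite)
  ultimately show ?thesis by simp
qed

text \<open>At level 1 the quantile is either \<open>\<infinity>\<close> or a point where \<open>F\<close> has already reached 1.\<close>

lemma measure_above_quantile:
  assumes "0 < p" "p \<le> 1" "p < 1 \<Longrightarrow> isCont F (Q F p)"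
  shows "measure (interval_measure F) {x. quantile F p < ereal x} = 1 - p"
proof -
  interpret real_distribution "interval_measure F" by (rule real_distribution_law)
  have above: "measure (interval_measure F) {x. quantile F p < ereal x} = 1 - F q"
    if "quantile F p = ereal q" for q
  proof -
    have "{x. quantile F p < ereal x} = UNIV - {..q}" using that by auto
    then show ?thesis
      using prob_compl[of "{..q}"] fun_cong[OF cdf_law, of q] by (simp add: cdf_def)
  qed
  show ?thesis
  proof (cases "p = 1")
    case False
    with assms have "0 < p" "p < 1" "isCont F (Q F p)" by auto
    then show ?thesis using above[OF quantile_finite] F_Q_eq by simp
  next
    case True
    show ?thesis
    proof (cases "quantile F p")
      case (real q)
      then have "F q = 1" using quantile_le_iff[of p q] F_bounds(2)[of q] True by simp
      with above[OF real] True show ?thesis by simp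
    next
      case PInf
      with True show ?thesis by simp
    next
      case MInf
      then have "1 \<le> F x" for x using quantile_le_iff[of p x] True by simp
      then have "(1::real) \<le> 0" by (intro tendsto_lowerbound[OF F_at_bot]) auto
      then show ?thesis by simp
    qed
  qed
qed

section \<open>Integrals of functions of the distribution function\<close>

text \<open>The central identity, for a function \<open>H\<close> with density \<open>w\<close> on the unit interval and
  \<open>H 0 = H 1 = 0\<close>. The layer cake formula is applied to \<open>Q F\<close> for the whole line. Truncating the
  integral at \<open>x\<close> amounts to replacing \<open>Q F\<close> by its minimum with \<open>x\<close>: then all of the
  mass of \<open>w\<close> is counted from \<open>x\<close> on, and that total is 0.\<close>

lemma integral_primitive_cdf:
  fixes w H :: "real \<Rightarrow> real"
  assumes w: "integrable lborel w"
    and supp: "\<And>u. u \<notin> {0<..<1} \<Longrightarrow> w u = 0"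
    and wQ: "integrable lborel (\<lambda>u. w u * Q F u)"
    and H: "\<And>t. 0 \<le> t \<Longrightarrow> t \<le> 1 \<Longrightarrow> H t = (LBINT u. w u * indicator {..t} u)"
    and H1: "H 1 = 0"
  shows "integrable lborel (\<lambda>y. H (F y))"
    and "(LBINT y. H (F y)) = - (LBINT u. w u * Q F u)"
    and "(LBINT y:{..x}. H (F y)) = - (LBINT u. w u * min x (Q F u))"
proof -
  have zero: "(LBINT u. w u) = 0"
  proof -
    have "(\<lambda>u. w u * indicator {..1} u) = w"
      using supp by (auto simp: fun_eq_iff split: split_indicator)
    then show ?thesis using H[of 1] H1 by simp
  qed
  have primitive: "(LBINT u. w u * indicator {Q F u..} y) = H (F y)" for y
  proof -
    have "(\<lambda>u. w u * indicator {Q F u..} y) = (\<lambda>u. w u * indicator {..F y} u)"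
      using supp Q_le_iff[of _ y] by (force simp: fun_eq_iff split: split_indicator)
    then show ?thesis using H[of "F y"] F_bounds by simp
  qed
  show "integrable lborel (\<lambda>y. H (F y))" "(LBINT y. H (F y)) = - (LBINT u. w u * Q F u)"
    using layer_cake_signed[OF sigma_finite_lborel w _ wQ zero] by (simp_all add: primitive)
  have wm: "integrable lborel (\<lambda>u. w u * min x (Q F u))"
  proof -
    have "integrable lborel (\<lambda>u. \<bar>x\<bar> * \<bar>w u\<bar> + \<bar>w u * Q F u\<bar>)"
      using w wQ by auto
    moreover have "(\<lambda>u. w u * min x (Q F u)) \<in> borel_measurable lborel"
      using w by measurable
    moreover have "\<bar>w u * min x (Q F u)\<bar> \<le> \<bar>x\<bar> * \<bar>w u\<bar> + \<bar>w u * Q F u\<bar>" for u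
    proof -
      have "\<bar>min x (Q F u)\<bar> \<le> \<bar>x\<bar> + \<bar>Q F u\<bar>" by auto
      from mult_left_mono[OF this, of "\<bar>w u\<bar>"] show ?thesis by (simp add: abs_mult algebra_simps)
    qed
    then have "AE u in lborel. norm (w u * min x (Q F u)) \<le> norm (\<bar>x\<bar> * \<bar>w u\<bar> + \<bar>w u * Q F u\<bar>)"
      by (intro AE_I2) (auto intro: order_trans abs_ge_self)
    ultimately show ?thesis by (rule Bochner_Integration.integrable_bound)
  qed
  have trunc: "(LBINT u. w u * indicator {min x (Q F u)..} y) = indicator {..<x} y * H (F y)" for y
  proof (cases "y < x")
    case True
    then have "(\<lambda>u. w u * indicator {min x (Q F u)..} y) = (\<lambda>u. w u * indicator {Q F u..} y)"
      by (auto simp: fun_eq_iff split: split_indicator)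
    with True show ?thesis by (simp add: primitive)
  next
    case False
    then have "(\<lambda>u. w u * indicator {min x (Q F u)..} y) = w"
      by (auto simp: fun_eq_iff split: split_indicator)
    with False show ?thesis by (simp add: zero)
  qed
  have "(LBINT y:{..x}. H (F y)) = (LBINT y:{..<x}. H (F y))"
    unfolding set_lebesgue_integral_def
    by (rule integral_discrete_difference[of "{x}"]) (auto split: split_indicator)
  also have "\<dots> = - (LBINT u. w u * min x (Q F u))"
    using layer_cake_signed(2)[OF sigma_finite_lborel w _ wm zero]
    by (simp add: trunc set_lebesgue_integral_def)
  finally show "(LBINT y:{..x}. H (F y)) = - (LBINT u. w u * min x (Q F u))" .
qed

lemma set_integrable_min_Q:
  assumes "set_integrable lborel {p<..<r} (Q F)"
  shows "set_integrable lborel {p<..<r} (\<lambda>u. min x (Q F u))"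
proof -
  have "set_integrable lborel {p<..<r} (\<lambda>u. x)"
    using integrable_indicator_Ioo by (simp add: set_integrable_def)
  then have "integrable lborel (\<lambda>u. min (indicator {p<..<r} u * x) (indicator {p<..<r} u * Q F u))"
    using assms by (intro integrable_min) (auto simp: set_integrable_def)
  then show ?thesis unfolding set_integrable_def
    by (rule Bochner_Integration.integrable_cong[THEN iffD1, rotated -1])
       (auto split: split_indicator)
qed

lemma integral_min_Q_below:
  assumes "0 \<le> p" "p \<le> r" "r \<le> 1" "ereal x \<le> quantile F p"
  shows "(LBINT u:{p<..<r}. min x (Q F u)) = (r - p) * x"
proof -
  have "min x (Q F u) = x" if "u \<in> {p<..<r}" for u
  proof -
    have "ereal x \<le> quantile F u" using assms quantile_mono[of p u] that by auto
    then show ?thesis using le_Q_iff[of u x] that assms by auto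
  qed
  then have "(LBINT u:{p<..<r}. min x (Q F u)) = (LBINT u:{p<..<r}. x)"
    by (intro set_lebesgue_integral_cong) auto
  then show ?thesis using assms by (simp add: set_lebesgue_integral_def)
qed

lemma integral_min_Q_above:
  assumes "0 \<le> p" "r \<le> 1" "r \<le> F x"
  shows "(LBINT u:{p<..<r}. min x (Q F u)) = (LBINT u:{p<..<r}. Q F u)"
proof (rule set_lebesgue_integral_cong)
  show "\<forall>u. u \<in> {p<..<r} \<longrightarrow> min x (Q F u) = Q F u"
    using assms Q_le_iff[of _ x] by (auto simp: min_absorb2)
qed simp

text \<open>The range of \<open>x\<close> is closed at the quantile of \<open>r\<close>, where \<open>F x\<close> may exceed \<open>r\<close>
  because of a jump. The formula survives since \<open>Q F\<close> equals \<open>x\<close> on the levels between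
  \<open>r\<close> and \<open>F x\<close>, so what the first integral gains the last term takes away.\<close>

lemma integral_min_Q_between:
  assumes "0 \<le> p" "p \<le> r" "r \<le> 1" "p \<le> F x" "ereal x \<le> quantile F r"
    and int: "set_integrable lborel {p<..<r} (Q F)"
  shows "(LBINT u:{p<..<r}. min x (Q F u)) = (LBINT u=p..F x. Q F u) + (r - F x) * x"
proof -
  have ge: "x \<le> Q F u" if "r \<le> u" "0 < u" "u < 1" for u
    using that assms quantile_mono[of r u] by (auto simp: le_Q_iff)
  \<comment> \<open>The integrals are joined at \<open>F x\<close>, which may lie beyond \<open>r\<close>; the integrand is \<open>x\<close> from \<open>r\<close> on.\<close>
  define s where "s = max r (F x)"
  have s: "p \<le> s" "s \<le> 1" "r \<le> s" using assms F_bounds by (auto simp: s_def)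
  have "set_integrable lborel {p<..<s} (\<lambda>u. min x (Q F u))"
    unfolding set_integrable_def
  proof (rule Bochner_Integration.integrable_bound)
    show "integrable lborel (\<lambda>u. \<bar>indicator {p<..<r} u * Q F u\<bar> + indicator {p<..<s} u * \<bar>x\<bar>)"
      using int integrable_indicator_Ioo[of p s] by (auto simp: set_integrable_def)
    show "AE u in lborel. norm (indicator {p<..<s} u *\<^sub>R min x (Q F u))
        \<le> norm (\<bar>indicator {p<..<r} u * Q F u\<bar> + indicator {p<..<s} u * \<bar>x\<bar>)"
    proof (rule AE_I2)
      fix u
      have "min x (Q F u) = x" if "u \<in> {p<..<s}" "\<not> u < r"
        using ge[of u] that s assms by auto
      then show "norm (indicator {p<..<s} u *\<^sub>R min x (Q F u))
        \<le> norm (\<bar>indicator {p<..<r} u * Q F u\<bar> + indicator {p<..<s} u * \<bar>x\<bar>)"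
        using s by (auto split: split_indicator)
    qed
  qed simp
  then have "interval_lebesgue_integrable lborel p s (\<lambda>u. min x (Q F u))"
    using s by (simp add: interval_lebesgue_integrable_def)
  moreover have "min (ereal p) (min (ereal (F x)) (ereal r)) = p" "max (ereal p) (max (ereal (F x)) (ereal r)) = s"
    using assms by (auto simp: s_def min_def max_def)
  ultimately have "(LBINT u=p..F x. min x (Q F u)) + (LBINT u=F x..r. min x (Q F u))
      = (LBINT u=p..r. min x (Q F u))"
    by (intro interval_integral_sum) simp
  moreover have "(LBINT u=p..F x. min x (Q F u)) = (LBINT u=p..F x. Q F u)"
    using assms F_bounds[of x] Q_le_iff[of _ x]
    by (intro interval_integral_cong) (auto simp: min_absorb2)
  moreover have "(LBINT u=F x..r. min x (Q F u)) = (LBINT u=F x..r. x)"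
  proof (rule interval_integral_cong)
    fix u assume "u \<in> einterval (min (ereal (F x)) (ereal r)) (max (ereal (F x)) (ereal r))"
    then have u: "min (F x) r < u" "u < max (F x) r"
      by (auto simp: min_def max_def split: if_splits)
    then have u01: "0 < u" "u < 1" using F_bounds[of x] assms by auto
    show "min x (Q F u) = x"
    proof (cases "r \<le> u")
      case False
      then have "\<not> Q F u \<le> x" using u u01 by (auto simp: Q_le_iff)
      then show ?thesis by simp
    qed (use ge[of u] u01 in auto)
  qed
  moreover have "(LBINT u=p..r. min x (Q F u)) = (LBINT u:{p<..<r}. min x (Q F u))"
    using assms by (simp add: interval_lebesgue_integral_le_eq)
  ultimately show ?thesis by (simp add: mult.commute)
qed

lemma set_integrable_times_Q:
  assumes "set_integrable lborel {p<..<r} (Q F)" "0 \<le> p" "r \<le> 1"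
  shows "set_integrable lborel {p<..<r} (\<lambda>u. u * Q F u)"
  unfolding set_integrable_def
proof (rule Bochner_Integration.integrable_bound)
  show "integrable lborel (\<lambda>u. indicator {p<..<r} u *\<^sub>R Q F u)"
    using assms(1) by (simp add: set_integrable_def)
  show "AE u in lborel. norm (indicator {p<..<r} u *\<^sub>R (u * Q F u)) \<le> norm (indicator {p<..<r} u *\<^sub>R Q F u)"
    using assms(2,3) by (intro AE_I2) (auto simp: abs_mult mult_left_le_one_le split: split_indicator)
qed simp

end

section \<open>The smooth trimming weight as a primitive\<close>

locale smooth_trimming = real_cdf +
  fixes \<alpha> \<gamma> :: real
  assumes \<alpha>: "0 \<le> \<alpha>" "\<alpha> < \<gamma>" and \<gamma>: "\<gamma> \<le> 1 / 2"
    and lower_tail: "set_integrable lborel {\<alpha><..<\<gamma>} (Q F)"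
    and upper_tail: "set_integrable lborel {1 - \<gamma><..<1 - \<alpha>} (Q F)"
begin

abbreviation J :: "real \<Rightarrow> real" where "J \<equiv> ST_weight \<alpha> \<gamma>"

definition J' :: "real \<Rightarrow> real" where
  "J' u = (indicator {\<alpha><..<\<gamma>} u - indicator {1 - \<gamma><..<1 - \<alpha>} u) / (\<gamma> - \<alpha>)"

text \<open>The piecewise derivative of \<open>(1 - t) * J t\<close>, which is a quadratic polynomial on each of the two
  smoothing intervals and \<open>1 - t\<close> between them.\<close>

definition W' :: "real \<Rightarrow> real" where
  "W' u = indicator {\<alpha><..<\<gamma>} u * ((1 + \<alpha> - 2 * u) / (\<gamma> - \<alpha>)) - indicator {\<gamma><..<1 - \<gamma>} u
     - indicator {1 - \<gamma><..<1 - \<alpha>} u * ((2 - \<alpha> - 2 * u) / (\<gamma> - \<alpha>))"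

lemma J_eq_integral: "J t = (LBINT u. J' u * indicator {..t} u)"
proof -
  have "has_bochner_integral lborel (\<lambda>u. 1 / (\<gamma> - \<alpha>) *
       (indicator {\<alpha><..<\<gamma>} u * (1 + 0 * u) * indicator {..t} u
        - indicator {1 - \<gamma><..<1 - \<alpha>} u * (1 + 0 * u) * indicator {..t} u))
     (1 / (\<gamma> - \<alpha>) * ((1 * (max \<alpha> (min \<gamma> t) - \<alpha>) + 0 * ((max \<alpha> (min \<gamma> t))\<^sup>2 - \<alpha>\<^sup>2) / 2)
        - (1 * (max (1 - \<gamma>) (min (1 - \<alpha>) t) - (1 - \<gamma>))
           + 0 * ((max (1 - \<gamma>) (min (1 - \<alpha>) t))\<^sup>2 - (1 - \<gamma>)\<^sup>2) / 2)))"
    using \<alpha> by (intro has_bochner_integral_mult_right has_bochner_integral_diff integral_affine_below) auto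
  moreover have "(\<lambda>u. 1 / (\<gamma> - \<alpha>) *
       (indicator {\<alpha><..<\<gamma>} u * (1 + 0 * u) * indicator {..t} u
        - indicator {1 - \<gamma><..<1 - \<alpha>} u * (1 + 0 * u) * indicator {..t} u))
     = (\<lambda>u. J' u * indicator {..t} u)"
    by (auto simp: J'_def fun_eq_iff diff_divide_distrib split: split_indicator)
  moreover have "1 / (\<gamma> - \<alpha>) * ((1 * (max \<alpha> (min \<gamma> t) - \<alpha>) + 0 * ((max \<alpha> (min \<gamma> t))\<^sup>2 - \<alpha>\<^sup>2) / 2)
        - (1 * (max (1 - \<gamma>) (min (1 - \<alpha>) t) - (1 - \<gamma>))
           + 0 * ((max (1 - \<gamma>) (min (1 - \<alpha>) t))\<^sup>2 - (1 - \<gamma>)\<^sup>2) / 2)) = J t"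
    using \<alpha> \<gamma> by (auto simp: ST_weight_def max_def min_def field_simps)
  ultimately show ?thesis by (metis has_bochner_integral_integral_eq)
qed

lemma W_eq_integral: "(1 - t) * J t = (LBINT u. W' u * indicator {..t} u)"
proof -
  define A where "A = max \<alpha> (min \<gamma> t)"
  define M where "M = max \<gamma> (min (1 - \<gamma>) t)"
  define B where "B = max (1 - \<gamma>) (min (1 - \<alpha>) t)"
  let ?A = "(1 + \<alpha>) * (A - \<alpha>) + (-2) * (A\<^sup>2 - \<alpha>\<^sup>2) / 2"
  let ?M = "1 * (M - \<gamma>) + 0 * (M\<^sup>2 - \<gamma>\<^sup>2) / 2"
  let ?B = "(2 - \<alpha>) * (B - (1 - \<gamma>)) + (-2) * (B\<^sup>2 - (1 - \<gamma>)\<^sup>2) / 2"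
  \<comment> \<open>With \<open>d\<close> for \<open>\<gamma> - \<alpha>\<close> the denominators are atomic and can be cleared.\<close>
  obtain d where d: "\<gamma> = \<alpha> + d" "d \<noteq> 0" using that[of "\<gamma> - \<alpha>"] \<alpha> by simp
  have "has_bochner_integral lborel (\<lambda>u.
       1 / (\<gamma> - \<alpha>) * (indicator {\<alpha><..<\<gamma>} u * ((1 + \<alpha>) + (-2) * u) * indicator {..t} u)
        - indicator {\<gamma><..<1 - \<gamma>} u * (1 + 0 * u) * indicator {..t} u
        - 1 / (\<gamma> - \<alpha>) * (indicator {1 - \<gamma><..<1 - \<alpha>} u * ((2 - \<alpha>) + (-2) * u) * indicator {..t} u))
     (1 / (\<gamma> - \<alpha>) * ?A - ?M - 1 / (\<gamma> - \<alpha>) * ?B)"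
    unfolding A_def M_def B_def
    using \<alpha> \<gamma> by (intro has_bochner_integral_mult_right has_bochner_integral_diff integral_affine_below) auto
  moreover have "(\<lambda>u.
       1 / (\<gamma> - \<alpha>) * (indicator {\<alpha><..<\<gamma>} u * ((1 + \<alpha>) + (-2) * u) * indicator {..t} u)
        - indicator {\<gamma><..<1 - \<gamma>} u * (1 + 0 * u) * indicator {..t} u
        - 1 / (\<gamma> - \<alpha>) * (indicator {1 - \<gamma><..<1 - \<alpha>} u * ((2 - \<alpha>) + (-2) * u) * indicator {..t} u))
     = (\<lambda>u. W' u * indicator {..t} u)"
    by (auto simp: W'_def fun_eq_iff split: split_indicator)
  moreover have "1 / (\<gamma> - \<alpha>) * ?A - ?M - 1 / (\<gamma> - \<alpha>) * ?B = (1 - t) * J t"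
  proof -
    consider "t < \<alpha>" | "\<alpha> \<le> t" "t < \<gamma>" | "\<gamma> \<le> t" "t \<le> 1 - \<gamma>" | "1 - \<gamma> < t" "t \<le> 1 - \<alpha>" | "1 - \<alpha> < t"
      by linarith
    then show ?thesis
    proof cases
      case 1
      then have eqs: "A = \<alpha>" "M = \<gamma>" "B = 1 - \<gamma>" "J t = 0"
        using \<alpha> \<gamma> by (auto simp: A_def M_def B_def ST_weight_def)
      then show ?thesis by simp
    next
      case 2
      then have eqs: "A = t" "M = \<gamma>" "B = 1 - \<gamma>" "J t = (t - \<alpha>) / (\<gamma> - \<alpha>)"
        using \<alpha> \<gamma> by (auto simp: A_def M_def B_def ST_weight_def)
      show ?thesis unfolding eqs using d(2) by (simp add: d(1) field_simps power2_eq_square)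
    next
      case 3
      then have eqs: "A = \<gamma>" "M = t" "B = 1 - \<gamma>" "J t = 1"
        using \<alpha> \<gamma> by (auto simp: A_def M_def B_def ST_weight_def)
      show ?thesis unfolding eqs using d(2) by (simp add: d(1) field_simps power2_eq_square)
    next
      case 4
      then have eqs: "A = \<gamma>" "M = 1 - \<gamma>" "B = t" "J t = (1 - t - \<alpha>) / (\<gamma> - \<alpha>)"
        using \<alpha> \<gamma> by (auto simp: A_def M_def B_def ST_weight_def)
      show ?thesis unfolding eqs using d(2) by (simp add: d(1) field_simps power2_eq_square)
    next
      case 5
      then have eqs: "A = \<gamma>" "M = 1 - \<gamma>" "B = 1 - \<alpha>" "J t = 0"
        using \<alpha> \<gamma> by (auto simp: A_def M_def B_def ST_weight_def)
      show ?thesis unfolding eqs using d(2) by (simp add: d(1) field_simps power2_eq_square)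
    qed
  qed
  ultimately show ?thesis by (metis has_bochner_integral_integral_eq)
qed

lemma set_integrable_Q_middle: "set_integrable lborel {\<gamma><..<1 - \<gamma>} (Q F)"
  unfolding set_integrable_def
proof (rule Bochner_Integration.integrable_bound)
  show "integrable lborel (\<lambda>u. indicator {\<gamma><..<1 - \<gamma>} u * (\<bar>Q F \<gamma>\<bar> + \<bar>Q F (1 - \<gamma>)\<bar>))"
    using integrable_indicator_Ioo by auto
  have "\<bar>Q F u\<bar> \<le> \<bar>Q F \<gamma>\<bar> + \<bar>Q F (1 - \<gamma>)\<bar>" if "u \<in> {\<gamma><..<1 - \<gamma>}" for u
    using Q_mono[of \<gamma> u] Q_mono[of u "1 - \<gamma>"] that \<alpha> \<gamma> by auto
  then show "AE u in lborel. norm (indicator {\<gamma><..<1 - \<gamma>} u *\<^sub>R Q F u)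
      \<le> norm (indicator {\<gamma><..<1 - \<gamma>} u * (\<bar>Q F \<gamma>\<bar> + \<bar>Q F (1 - \<gamma>)\<bar>))"
    by (intro AE_I2) (auto split: split_indicator)
qed simp

lemma J'_integrable: "integrable lborel J'"
  unfolding J'_def[abs_def] using integrable_indicator_Ioo by auto

lemma W'_integrable: "integrable lborel W'"
proof (rule Bochner_Integration.integrable_bound)
  let ?C = "(2::real) / (\<gamma> - \<alpha>) + 1"
  show "integrable lborel (\<lambda>u. indicator {0<..<1::real} u * (2 * ?C))"
    using integrable_indicator_Ioo by auto
  show "AE u in lborel. norm (W' u) \<le> norm (indicator {0<..<1} u * (2 * ?C))"
  proof (rule AE_I2)
    fix u
    show "norm (W' u) \<le> norm (indicator {0<..<1} u * (2 * ?C))"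
    proof (cases "u \<in> {0<..<1}")
      case True
      define X where "X = (1 + \<alpha> - 2 * u) / (\<gamma> - \<alpha>)"
      define Y where "Y = (2 - \<alpha> - 2 * u) / (\<gamma> - \<alpha>)"
      have "\<bar>X\<bar> \<le> 2 / (\<gamma> - \<alpha>)" "\<bar>Y\<bar> \<le> 2 / (\<gamma> - \<alpha>)" "0 \<le> 2 / (\<gamma> - \<alpha>)"
        using True \<alpha> \<gamma> by (auto simp: X_def Y_def abs_divide intro!: divide_right_mono)
      then have "\<bar>W' u\<bar> \<le> 2 * ?C"
        unfolding W'_def X_def[symmetric] Y_def[symmetric] by (auto split: split_indicator)
      with True show ?thesis by simp
    next
      case False
      then show ?thesis using \<alpha> \<gamma> by (auto simp: W'_def split: split_indicator)
    qed
  qed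
  show "W' \<in> borel_measurable lborel" unfolding W'_def[abs_def] by measurable
qed

lemma J'_support: "u \<notin> {0<..<1} \<Longrightarrow> J' u = 0" and W'_support: "u \<notin> {0<..<1} \<Longrightarrow> W' u = 0"
  using \<alpha> \<gamma> by (auto simp: J'_def W'_def split: split_indicator)

lemma J_1: "J 1 = 0"
  using \<alpha> \<gamma> by (auto simp: ST_weight_def)

lemma J'_min_Q:
  "(LBINT u. J' u * min x (Q F u))
     = ((LBINT u:{\<alpha><..<\<gamma>}. min x (Q F u)) - (LBINT u:{1 - \<gamma><..<1 - \<alpha>}. min x (Q F u))) / (\<gamma> - \<alpha>)"
proof -
  have "J' u * min x (Q F u) = (indicator {\<alpha><..<\<gamma>} u *\<^sub>R min x (Q F u)
      - indicator {1 - \<gamma><..<1 - \<alpha>} u *\<^sub>R min x (Q F u)) / (\<gamma> - \<alpha>)" for u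
    by (simp add: J'_def left_diff_distrib)
  then show ?thesis
    using set_integrable_min_Q[OF lower_tail] set_integrable_min_Q[OF upper_tail]
    by (simp add: set_lebesgue_integral_def set_integrable_def)
qed

lemma J'_Q_integrable: "integrable lborel (\<lambda>u. J' u * Q F u)"
proof -
  have "(\<lambda>u. J' u * Q F u) = (\<lambda>u. (indicator {\<alpha><..<\<gamma>} u *\<^sub>R Q F u
      - indicator {1 - \<gamma><..<1 - \<alpha>} u *\<^sub>R Q F u) / (\<gamma> - \<alpha>))"
    by (simp add: J'_def left_diff_distrib)
  then show ?thesis
    using lower_tail upper_tail by (simp add: set_integrable_def)
qed

lemma integrable_J_F: "integrable lborel (\<lambda>y. J (F y))"
  by (rule integral_primitive_cdf[OF J'_integrable J'_support J'_Q_integrable J_eq_integral J_1])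

lemma integral_J_F_atMost:
  "(LBINT y:{..x}. J (F y))
     = ((LBINT u:{1 - \<gamma><..<1 - \<alpha>}. min x (Q F u)) - (LBINT u:{\<alpha><..<\<gamma>}. min x (Q F u))) / (\<gamma> - \<alpha>)"
  using integral_primitive_cdf(3)[OF J'_integrable J'_support J'_Q_integrable J_eq_integral J_1, of x]
  by (simp add: J'_min_Q minus_divide_left)

text \<open>The constant is minus the integral of \<open>W'\<close> against the quantile function. The terms in
  \<open>Q F \<gamma>\<close> and \<open>Q F (1 - \<gamma>)\<close> of \<open>I0\<close> have total coefficient zero, so they cancel.\<close>

lemma I0_eq_integral: "(LBINT y. (1 - F y) * J (F y)) = I0 F \<alpha> \<gamma>"
proof -
  let ?d = "\<gamma> - \<alpha>"
  have ord: "\<alpha> \<le> \<gamma>" "\<gamma> \<le> 1 - \<gamma>" "1 - \<gamma> \<le> 1 - \<alpha>" using \<alpha> \<gamma> by auto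
  note ints = lower_tail upper_tail set_integrable_Q_middle set_integrable_times_Q[OF lower_tail]
    set_integrable_times_Q[OF upper_tail]
  define f where "f u =
      (1 + \<alpha>) / ?d * (indicator {\<alpha><..<\<gamma>} u *\<^sub>R Q F u) - 2 / ?d * (indicator {\<alpha><..<\<gamma>} u *\<^sub>R (u * Q F u))
      - indicator {\<gamma><..<1 - \<gamma>} u *\<^sub>R Q F u
      - (2 - \<alpha>) / ?d * (indicator {1 - \<gamma><..<1 - \<alpha>} u *\<^sub>R Q F u)
      + 2 / ?d * (indicator {1 - \<gamma><..<1 - \<alpha>} u *\<^sub>R (u * Q F u))" for u
  have f: "W' u * Q F u = f u" for u
    by (auto simp: f_def W'_def diff_divide_distrib add_divide_distrib algebra_simps split: split_indicator)
  have int: "integrable lborel (\<lambda>u. W' u * Q F u)"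
    unfolding f unfolding f_def
    using ints \<alpha> \<gamma> by (auto simp: set_integrable_def)
  have val: "(LBINT u. W' u * Q F u) =
      (1 + \<alpha>) / ?d * (LBINT u=\<alpha>..\<gamma>. Q F u) - 2 / ?d * (LBINT u=\<alpha>..\<gamma>. u * Q F u)
      - (LBINT u=\<gamma>..1 - \<gamma>. Q F u)
      - (2 - \<alpha>) / ?d * (LBINT u=1 - \<gamma>..1 - \<alpha>. Q F u)
      + 2 / ?d * (LBINT u=1 - \<gamma>..1 - \<alpha>. u * Q F u)"
    unfolding f unfolding f_def
    using ints \<alpha> \<gamma> ord by (simp add: set_integrable_def interval_lebesgue_integral_le_eq set_lebesgue_integral_def)
  have algebra: "- ((1 + \<alpha>) / ?d * q1 - 2 / ?d * q2 - q3 - (2 - \<alpha>) / ?d * q4 + 2 / ?d * q5)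
      = 1 / ?d * ((\<gamma> + \<alpha> * \<gamma> - \<gamma>\<^sup>2 - \<alpha>) * q - (1 + \<alpha>) * q1 + 2 * q2 + (2 - \<alpha>) * q4
          + (\<alpha> * \<gamma> - \<gamma>\<^sup>2) * r - 2 * q5) + q3 + r * \<gamma> + q * \<gamma> - q" for q1 q2 q3 q4 q5 q r :: real
  proof -
    obtain d where d: "\<gamma> = \<alpha> + d" "d \<noteq> 0" using that[of "\<gamma> - \<alpha>"] \<alpha> by simp
    show ?thesis using d(2) by (simp add: d(1) field_simps power2_eq_square)
  qed
  have "(LBINT y. (1 - F y) * J (F y)) = - (LBINT u. W' u * Q F u)"
    by (rule integral_primitive_cdf(2)[OF W'_integrable W'_support int W_eq_integral]) simp_all
  also have "\<dots> = I0 F \<alpha> \<gamma>"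
    unfolding val I0_def by (rule algebra)
  finally show ?thesis .
qed

section \<open>The influence function\<close>

text \<open>The influence function without its centring constant.\<close>

definition L :: "real \<Rightarrow> real" where
  "L x = (LBINT y:{..x}. J (F y))"

lemma L_influence_eq: "L_influence J F x = L x - I0 F \<alpha> \<gamma>"
  by (simp add: L_influence_def L_def I0_eq_integral)

lemma levels: "0 \<le> \<alpha>" "\<alpha> \<le> \<gamma>" "0 < \<gamma>" "\<gamma> \<le> 1 - \<gamma>" "1 - \<gamma> \<le> 1 - \<alpha>" "1 - \<gamma> < 1" "1 - \<alpha> \<le> 1"
  using \<alpha> \<gamma> by auto

lemma L_below_\<alpha>:
  assumes "ereal x \<le> quantile F \<alpha>"
  shows "L x = 0"
proof -
  have "ereal x \<le> quantile F (1 - \<gamma>)"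
    using assms quantile_mono[of \<alpha> "1 - \<gamma>"] levels by auto
  with assms show ?thesis
    using levels by (simp add: L_def integral_J_F_atMost integral_min_Q_below)
qed

text \<open>Here and in the lemmas for the other ranges of \<open>x\<close>, both end points are included, although the
  case distinction assigns each end point to only one case. The overlap is needed for the
  variance: when \<open>F\<close> jumps, \<open>Q F u\<close> sits at an end point for a whole interval of levels \<open>u\<close>.\<close>

lemma L_\<alpha>_to_\<gamma>:
  assumes "quantile F \<alpha> \<le> ereal x" "ereal x \<le> quantile F \<gamma>"
  shows "L x = E1 F \<alpha> \<gamma> x"
proof -
  have "ereal x \<le> quantile F (1 - \<gamma>)"
    using assms quantile_mono[of \<gamma> "1 - \<gamma>"] levels by auto
  then have "(LBINT u:{1 - \<gamma><..<1 - \<alpha>}. min x (Q F u)) = (\<gamma> - \<alpha>) * x"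
    using levels by (simp add: integral_min_Q_below)
  moreover have "(LBINT u:{\<alpha><..<\<gamma>}. min x (Q F u)) = (LBINT u=\<alpha>..F x. Q F u) + (\<gamma> - F x) * x"
    using assms levels lower_tail by (intro integral_min_Q_between) (auto simp: quantile_le_iff)
  ultimately show ?thesis
    by (simp add: L_def integral_J_F_atMost E1_def) (simp add: algebra_simps)
qed

lemma L_\<gamma>_to_upper_\<gamma>:
  assumes "quantile F \<gamma> \<le> ereal x" "ereal x \<le> quantile F (1 - \<gamma>)"
  shows "L x = E2 F \<alpha> \<gamma> x"
proof -
  have "(LBINT u:{1 - \<gamma><..<1 - \<alpha>}. min x (Q F u)) = (\<gamma> - \<alpha>) * x"
    using assms levels by (simp add: integral_min_Q_below)
  moreover have "(LBINT u:{\<alpha><..<\<gamma>}. min x (Q F u)) = (LBINT u=\<alpha>..\<gamma>. Q F u)"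
    using assms levels by (simp add: integral_min_Q_above quantile_le_iff interval_lebesgue_integral_le_eq)
  ultimately show ?thesis
    unfolding L_def integral_J_F_atMost E2_def using \<alpha> by (simp add: diff_divide_distrib right_diff_distrib)
qed

lemma L_upper_\<gamma>_to_upper_\<alpha>:
  assumes "quantile F (1 - \<gamma>) \<le> ereal x" "ereal x \<le> quantile F (1 - \<alpha>)"
  shows "L x = E3 F \<alpha> \<gamma> x"
proof -
  have B: "(LBINT u:{1 - \<gamma><..<1 - \<alpha>}. min x (Q F u))
      = (LBINT u=1 - \<gamma>..F x. Q F u) + (1 - \<alpha> - F x) * x"
    using assms levels upper_tail by (intro integral_min_Q_between) (auto simp: quantile_le_iff)
  have "\<gamma> \<le> F x" using assms(1) levels by (simp add: quantile_le_iff)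
  then have A: "(LBINT u:{\<alpha><..<\<gamma>}. min x (Q F u)) = (LBINT u=\<alpha>..\<gamma>. Q F u)"
    using levels by (simp add: integral_min_Q_above interval_lebesgue_integral_le_eq)
  obtain d where d: "\<gamma> - \<alpha> = d" "\<alpha> - \<gamma> = - d" "d \<noteq> 0"
    by (rule that[of "\<gamma> - \<alpha>"]) (use \<alpha> in auto)
  show ?thesis
    unfolding L_def integral_J_F_atMost A B E3_def d(1,2) using d(3) by (simp add: field_simps)
qed

lemma L_above_upper_\<alpha>:
  assumes "quantile F (1 - \<alpha>) \<le> ereal x"
  shows "L x = E4 F \<alpha> \<gamma>"
proof -
  have F: "1 - \<alpha> \<le> F x" "\<gamma> \<le> F x" using assms levels by (auto simp: quantile_le_iff)
  obtain d where d: "\<gamma> - \<alpha> = d" "\<alpha> - \<gamma> = - d" "d \<noteq> 0"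
    by (rule that[of "\<gamma> - \<alpha>"]) (use \<alpha> in auto)
  have L: "L x = ((LBINT u=1 - \<gamma>..1 - \<alpha>. Q F u) - (LBINT u=\<alpha>..\<gamma>. Q F u)) / (\<gamma> - \<alpha>)"
    using F levels
    by (simp add: L_def integral_J_F_atMost integral_min_Q_above interval_lebesgue_integral_le_eq)
  show ?thesis
    unfolding L E4_def d(1,2) using d(3) by (simp add: field_simps)
qed

lemma influence_by_cases:
  "L_influence J F x =
        (if ereal x < quantile F \<alpha> then - I0 F \<alpha> \<gamma>
         else if quantile F \<alpha> \<le> ereal x \<and> ereal x < quantile F \<gamma> then E1 F \<alpha> \<gamma> x - I0 F \<alpha> \<gamma>
         else if quantile F \<gamma> \<le> ereal x \<and> ereal x \<le> quantile F (1 - \<gamma>) then E2 F \<alpha> \<gamma> x - I0 F \<alpha> \<gamma>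
         else if quantile F (1 - \<gamma>) < ereal x \<and> ereal x \<le> quantile F (1 - \<alpha>) then E3 F \<alpha> \<gamma> x - I0 F \<alpha> \<gamma>
         else E4 F \<alpha> \<gamma> - I0 F \<alpha> \<gamma>)"
  by (auto simp: L_influence_eq L_below_\<alpha> L_\<alpha>_to_\<gamma> L_\<gamma>_to_upper_\<gamma> L_upper_\<gamma>_to_upper_\<alpha>
      intro!: L_above_upper_\<alpha>)

section \<open>The asymptotic variance\<close>

lemma J_nonneg: "0 \<le> J t"
  using \<alpha> by (auto simp: ST_weight_def)

lemma set_integrable_J_F: "S \<in> sets borel \<Longrightarrow> set_integrable lborel S (\<lambda>y. J (F y))"
  unfolding set_integrable_def using integrable_J_F by (intro integrable_mult_indicator) auto

lemma L_mono: "x \<le> y \<Longrightarrow> L x \<le> L y"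
  unfolding L_def set_lebesgue_integral_def
  by (intro integral_mono set_integrable_J_F[unfolded set_integrable_def])
     (auto simp: J_nonneg split: split_indicator)

text \<open>This bounds the influence function, so its square is integrable against every law; a variance
  formula in Bochner integrals depends on that, since they are 0 for functions that are not integrable.\<close>

lemma L_bounds: "0 \<le> L x" "L x \<le> (LBINT y. J (F y))"
proof -
  show "0 \<le> L x"
    unfolding L_def set_lebesgue_integral_def by (rule integral_nonneg_AE) (simp add: J_nonneg)
  show "L x \<le> (LBINT y. J (F y))"
    unfolding L_def set_lebesgue_integral_def
    by (intro integral_mono set_integrable_J_F[unfolded set_integrable_def] integrable_J_F)
       (auto simp: J_nonneg split: split_indicator)
qed

lemma measurable_L[measurable]: "L \<in> borel_measurable borel"
  by (intro borel_measurable_mono) (simp add: mono_def L_mono)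

lemma L_influence_bounded: "\<bar>L x - I0 F \<alpha> \<gamma>\<bar> \<le> (LBINT y. J (F y)) + \<bar>I0 F \<alpha> \<gamma>\<bar>"
  using L_bounds[of x] by auto

lemma L_influence_square_bounded:
  "(L x - I0 F \<alpha> \<gamma>)\<^sup>2 \<le> ((LBINT y. J (F y)) + \<bar>I0 F \<alpha> \<gamma>\<bar>)\<^sup>2"
  using power_mono[OF L_influence_bounded abs_ge_zero, of x 2] by simp

lemma Q_between:
  assumes "0 \<le> p" "r \<le> 1" "u \<in> {p<..<r}"
  shows "quantile F p \<le> ereal (Q F u)" "ereal (Q F u) \<le> quantile F r"
  using assms quantile_mono[of p u] quantile_mono[of u r] quantile_finite[of u] by auto

lemma quantile_range_integral_cong:
  assumes "0 \<le> p" "p \<le> r" "r \<le> 1"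
    and "\<And>x. quantile F p \<le> ereal x \<Longrightarrow> ereal x \<le> quantile F r \<Longrightarrow> g x = h x"
  shows "(LBINT u=p..r. g (Q F u)) = (LBINT u=p..r. h (Q F u))"
  using assms Q_between[of p r] by (intro interval_integral_cong) (auto simp: min_def max_def)

lemma variance_levels:
  "L_asymp_variance J F =
       \<alpha> * (I0 F \<alpha> \<gamma>)\<^sup>2
       + quantile_range_integral F \<alpha> \<gamma> (\<lambda>x. (E1 F \<alpha> \<gamma> x - I0 F \<alpha> \<gamma>)\<^sup>2)
       + quantile_range_integral F \<gamma> (1 - \<gamma>) (\<lambda>x. (E2 F \<alpha> \<gamma> x - I0 F \<alpha> \<gamma>)\<^sup>2)
       + quantile_range_integral F (1 - \<gamma>) (1 - \<alpha>) (\<lambda>x. (E3 F \<alpha> \<gamma> x - I0 F \<alpha> \<gamma>)\<^sup>2)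
       + \<alpha> * (E4 F \<alpha> \<gamma> - I0 F \<alpha> \<gamma>)\<^sup>2"
proof -
  let ?I = "I0 F \<alpha> \<gamma>"
  let ?g = "\<lambda>u. (L (Q F u) - ?I)\<^sup>2"
  let ?C = "((LBINT y. J (F y)) + \<bar>?I\<bar>)\<^sup>2"
  have int: "interval_lebesgue_integrable lborel p r ?g" for p r :: real
  proof -
    have "set_integrable lborel {a<..<b} ?g" for a b :: real
      unfolding set_integrable_def
    proof (rule Bochner_Integration.integrable_bound)
      show "integrable lborel (\<lambda>u. indicator {a<..<b} u * ?C)"
        using integrable_indicator_Ioo by auto
      show "AE u in lborel. norm (indicator {a<..<b} u *\<^sub>R ?g u) \<le> norm (indicator {a<..<b} u * ?C)"
        using L_influence_square_bounded by (intro AE_I2) (auto split: split_indicator)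
    qed measurable
    then show ?thesis by (simp add: interval_lebesgue_integrable_def)
  qed
  have join: "(LBINT u=p..q. ?g u) + (LBINT u=q..r. ?g u) = (LBINT u=p..r. ?g u)" for p q r :: real
    using int by (intro interval_integral_sum) (simp add: min_def max_def)
  have "L_asymp_variance J F = (LBINT u=0..1. ?g u)"
    unfolding L_asymp_variance_def L_influence_eq
    by (rule integral_interval_measure) measurable
  also have "\<dots> = (LBINT u=0..\<alpha>. ?g u) + (LBINT u=\<alpha>..\<gamma>. ?g u) + (LBINT u=\<gamma>..1 - \<gamma>. ?g u)
      + (LBINT u=1 - \<gamma>..1 - \<alpha>. ?g u) + (LBINT u=1 - \<alpha>..1. ?g u)"
    using join[of 0 \<alpha> \<gamma>] join[of 0 \<gamma> "1 - \<gamma>"] join[of 0 "1 - \<gamma>" "1 - \<alpha>"] join[of 0 "1 - \<alpha>" 1]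
    by (simp add: zero_ereal_def one_ereal_def)
  also have "(LBINT u=0..\<alpha>. ?g u) = (LBINT u=0..\<alpha>. ?I\<^sup>2)"
    using quantile_range_integral_cong[of 0 \<alpha> "\<lambda>x. (L x - ?I)\<^sup>2" "\<lambda>_. ?I\<^sup>2"] levels
    by (simp add: L_below_\<alpha> zero_ereal_def)
  also have "\<dots> = \<alpha> * ?I\<^sup>2"
    using interval_integral_const(2)[of 0 \<alpha> "?I\<^sup>2"] by (simp add: zero_ereal_def mult.commute)
  also have "(LBINT u=\<alpha>..\<gamma>. ?g u) = quantile_range_integral F \<alpha> \<gamma> (\<lambda>x. (E1 F \<alpha> \<gamma> x - ?I)\<^sup>2)"
    unfolding quantile_range_integral_def
    using levels by (intro quantile_range_integral_cong) (auto simp: L_\<alpha>_to_\<gamma>)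
  also have "(LBINT u=\<gamma>..1 - \<gamma>. ?g u) = quantile_range_integral F \<gamma> (1 - \<gamma>) (\<lambda>x. (E2 F \<alpha> \<gamma> x - ?I)\<^sup>2)"
    unfolding quantile_range_integral_def
    using levels by (intro quantile_range_integral_cong) (auto simp: L_\<gamma>_to_upper_\<gamma>)
  also have "(LBINT u=1 - \<gamma>..1 - \<alpha>. ?g u)
      = quantile_range_integral F (1 - \<gamma>) (1 - \<alpha>) (\<lambda>x. (E3 F \<alpha> \<gamma> x - ?I)\<^sup>2)"
    unfolding quantile_range_integral_def
    using levels by (intro quantile_range_integral_cong) (auto simp: L_upper_\<gamma>_to_upper_\<alpha>)
  also have "(LBINT u=1 - \<alpha>..1. ?g u) = (LBINT u=1 - \<alpha>..1. (E4 F \<alpha> \<gamma> - ?I)\<^sup>2)"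
    using quantile_range_integral_cong[of "1 - \<alpha>" 1 "\<lambda>x. (L x - ?I)\<^sup>2" "\<lambda>_. (E4 F \<alpha> \<gamma> - ?I)\<^sup>2"] levels
    by (simp add: L_above_upper_\<alpha> one_ereal_def)
  also have "\<dots> = \<alpha> * (E4 F \<alpha> \<gamma> - ?I)\<^sup>2"
    using interval_integral_const(2)[of "1 - \<alpha>" 1 "(E4 F \<alpha> \<gamma> - ?I)\<^sup>2"] by (simp add: one_ereal_def mult.commute)
  finally show ?thesis .
qed

text \<open>The five ranges of \<open>x\<close> partition the line. On the two outer ones the influence function is
  constant, and each of them has mass \<open>\<alpha>\<close>.\<close>

lemma variance_sets:
  assumes "\<alpha> > 0 \<longrightarrow> isCont F (Q F \<alpha>) \<and> isCont F (Q F (1 - \<alpha>))"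
  shows "L_asymp_variance J F =
       \<alpha> * (I0 F \<alpha> \<gamma>)\<^sup>2
       + (LINT x:{x. quantile F \<alpha> \<le> ereal x \<and> ereal x < quantile F \<gamma>}|interval_measure F.
            (E1 F \<alpha> \<gamma> x - I0 F \<alpha> \<gamma>)\<^sup>2)
       + (LINT x:{x. quantile F \<gamma> \<le> ereal x \<and> ereal x \<le> quantile F (1 - \<gamma>)}|interval_measure F.
            (E2 F \<alpha> \<gamma> x - I0 F \<alpha> \<gamma>)\<^sup>2)
       + (LINT x:{x. quantile F (1 - \<gamma>) < ereal x \<and> ereal x \<le> quantile F (1 - \<alpha>)}|interval_measure F.
            (E3 F \<alpha> \<gamma> x - I0 F \<alpha> \<gamma>)\<^sup>2)
       + \<alpha> * (E4 F \<alpha> \<gamma> - I0 F \<alpha> \<gamma>)\<^sup>2"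
    (is "_ = \<alpha> * ?I\<^sup>2 + (LINT x:?S1|?M. ?e1 x) + (LINT x:?S2|?M. ?e2 x) + (LINT x:?S3|?M. ?e3 x)
           + \<alpha> * ?e4")
proof -
  interpret real_distribution "interval_measure F" by (rule real_distribution_law)
  let ?S0 = "{x. ereal x < quantile F \<alpha>}" and ?S4 = "{x. quantile F (1 - \<alpha>) < ereal x}"
  let ?g = "\<lambda>x. (L x - ?I)\<^sup>2"
  have sets[measurable]: "?S0 \<in> sets ?M" "?S1 \<in> sets ?M" "?S2 \<in> sets ?M" "?S3 \<in> sets ?M" "?S4 \<in> sets ?M"
    unfolding sets_interval_measure by measurable
  have "integrable ?M ?g"
  proof (rule integrable_const_bound)
    show "AE x in ?M. norm (?g x) \<le> ((LBINT y. J (F y)) + \<bar>?I\<bar>)\<^sup>2"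
      using L_influence_square_bounded by (intro AE_I2) simp
  qed measurable
  then have int: "integrable ?M (\<lambda>x. indicator S x *\<^sub>R ?g x)" if "S \<in> sets ?M" for S
    using that by (intro integrable_mult_indicator)
  have pieces:
    "indicator ?S0 x *\<^sub>R ?g x = indicator ?S0 x * ?I\<^sup>2"
    "indicator ?S1 x *\<^sub>R ?g x = indicator ?S1 x *\<^sub>R ?e1 x"
    "indicator ?S2 x *\<^sub>R ?g x = indicator ?S2 x *\<^sub>R ?e2 x"
    "indicator ?S3 x *\<^sub>R ?g x = indicator ?S3 x *\<^sub>R ?e3 x"
    "indicator ?S4 x *\<^sub>R ?g x = indicator ?S4 x * ?e4" for x
    by (auto simp: L_below_\<alpha> L_\<alpha>_to_\<gamma> L_\<gamma>_to_upper_\<gamma> L_upper_\<gamma>_to_upper_\<alpha> L_above_upper_\<alpha>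
          split: split_indicator)
  have split: "?g x = indicator ?S0 x *\<^sub>R ?g x + indicator ?S1 x *\<^sub>R ?g x + indicator ?S2 x *\<^sub>R ?g x
      + indicator ?S3 x *\<^sub>R ?g x + indicator ?S4 x *\<^sub>R ?g x" for x
  proof -
    have "quantile F \<alpha> \<le> quantile F \<gamma>" "quantile F \<gamma> \<le> quantile F (1 - \<gamma>)"
        "quantile F (1 - \<gamma>) \<le> quantile F (1 - \<alpha>)"
      using levels by (auto intro: quantile_mono)
    then have "indicator ?S0 x + indicator ?S1 x + indicator ?S2 x + indicator ?S3 x + indicator ?S4 x = (1::real)"
      by (auto split: split_indicator)
    then show ?thesis by (simp only: real_scaleR_def distrib_right[symmetric] mult_1)
  qed
  have "L_asymp_variance J F = (LINT x|?M. ?g x)"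
    by (simp add: L_asymp_variance_def L_influence_eq)
  also have "\<dots> = (LINT x|?M. indicator ?S0 x *\<^sub>R ?g x + indicator ?S1 x *\<^sub>R ?g x + indicator ?S2 x *\<^sub>R ?g x
      + indicator ?S3 x *\<^sub>R ?g x + indicator ?S4 x *\<^sub>R ?g x)"
    by (rule Bochner_Integration.integral_cong) (simp_all only: split[symmetric])
  also have "\<dots> = (LINT x|?M. indicator ?S0 x *\<^sub>R ?g x) + (LINT x|?M. indicator ?S1 x *\<^sub>R ?g x)
      + (LINT x|?M. indicator ?S2 x *\<^sub>R ?g x) + (LINT x|?M. indicator ?S3 x *\<^sub>R ?g x)
      + (LINT x|?M. indicator ?S4 x *\<^sub>R ?g x)"
    by (simp only: Bochner_Integration.integral_add Bochner_Integration.integrable_add int sets)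
  also have "\<dots> = measure ?M ?S0 * ?I\<^sup>2 + (LINT x:?S1|?M. ?e1 x) + (LINT x:?S2|?M. ?e2 x)
      + (LINT x:?S3|?M. ?e3 x) + measure ?M ?S4 * ?e4"
    unfolding pieces by (simp add: set_lebesgue_integral_def)
  also have "measure ?M ?S0 = \<alpha>"
    using assms levels by (intro measure_below_quantile) auto
  also have "measure ?M ?S4 = \<alpha>"
    using assms levels measure_above_quantile[of "1 - \<alpha>"] by auto
  finally show ?thesis .
qed

end

theorem theorem1:
  fixes F :: "real \<Rightarrow> real" and \<alpha> \<gamma> :: real
  assumes "distribution_function F"
    and "0 \<le> \<alpha>" and "\<alpha> < \<gamma>" and "\<gamma> \<le> 1 / 2"
    and "L_influence_converges (ST_weight \<alpha> \<gamma>) F"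
    and "interval_lebesgue_integrable lborel (ereal \<alpha>) (ereal \<gamma>) (Q F)"
    and "interval_lebesgue_integrable lborel (ereal (1 - \<gamma>)) (ereal (1 - \<alpha>)) (Q F)"
  shows
    "(\<forall>x. L_influence (ST_weight \<alpha> \<gamma>) F x =
        (if ereal x < quantile F \<alpha> then - I0 F \<alpha> \<gamma>
         else if quantile F \<alpha> \<le> ereal x \<and> ereal x < quantile F \<gamma> then E1 F \<alpha> \<gamma> x - I0 F \<alpha> \<gamma>
         else if quantile F \<gamma> \<le> ereal x \<and> ereal x \<le> quantile F (1 - \<gamma>) then E2 F \<alpha> \<gamma> x - I0 F \<alpha> \<gamma>
         else if quantile F (1 - \<gamma>) < ereal x \<and> ereal x \<le> quantile F (1 - \<alpha>) then E3 F \<alpha> \<gamma> x - I0 F \<alpha> \<gamma>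
         else E4 F \<alpha> \<gamma> - I0 F \<alpha> \<gamma>))
     \<and>
     L_asymp_variance (ST_weight \<alpha> \<gamma>) F =
       \<alpha> * (I0 F \<alpha> \<gamma>)\<^sup>2
       + quantile_range_integral F \<alpha> \<gamma> (\<lambda>x. (E1 F \<alpha> \<gamma> x - I0 F \<alpha> \<gamma>)\<^sup>2)
       + quantile_range_integral F \<gamma> (1 - \<gamma>) (\<lambda>x. (E2 F \<alpha> \<gamma> x - I0 F \<alpha> \<gamma>)\<^sup>2)
       + quantile_range_integral F (1 - \<gamma>) (1 - \<alpha>) (\<lambda>x. (E3 F \<alpha> \<gamma> x - I0 F \<alpha> \<gamma>)\<^sup>2)
       + \<alpha> * (E4 F \<alpha> \<gamma> - I0 F \<alpha> \<gamma>)\<^sup>2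
     \<and>
     ((\<alpha> > 0 \<longrightarrow> isCont F (Q F \<alpha>) \<and> isCont F (Q F (1 - \<alpha>))) \<longrightarrow>
      L_asymp_variance (ST_weight \<alpha> \<gamma>) F =
       \<alpha> * (I0 F \<alpha> \<gamma>)\<^sup>2
       + (LINT x:{x. quantile F \<alpha> \<le> ereal x \<and> ereal x < quantile F \<gamma>}|interval_measure F.
            (E1 F \<alpha> \<gamma> x - I0 F \<alpha> \<gamma>)\<^sup>2)
       + (LINT x:{x. quantile F \<gamma> \<le> ereal x \<and> ereal x \<le> quantile F (1 - \<gamma>)}|interval_measure F.
            (E2 F \<alpha> \<gamma> x - I0 F \<alpha> \<gamma>)\<^sup>2)
       + (LINT x:{x. quantile F (1 - \<gamma>) < ereal x \<and> ereal x \<le> quantile F (1 - \<alpha>)}|interval_measure F.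
            (E3 F \<alpha> \<gamma> x - I0 F \<alpha> \<gamma>)\<^sup>2)
       + \<alpha> * (E4 F \<alpha> \<gamma> - I0 F \<alpha> \<gamma>)\<^sup>2)"
proof -
  interpret smooth_trimming F \<alpha> \<gamma>
    using assms by unfold_locales (auto simp: interval_lebesgue_integrable_def)
  show ?thesis
    using influence_by_cases variance_levels variance_sets by blast
qed
end
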